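(* Let $(P_1,\dots,P_d)\sim\text{Vec-NIFPP}(q_M,H,P_0)$. For any measurable set $A\subset\Theta$ and any $j\in\{1,\dots,d\}$, $\mathbb E[P_j(A)]=P_0(A)$. Additionally: (i) for any measurable sets $A,B\subset\Theta$ and any $j,l\in\{1,\dots,d\}$, $$\mathbb E[P_j(A)P_l(B)]-P_0(A)P_0(B)=\mathbb P\left(K_{(1,1)}=1\right)\left(P_0(A\cap B)-P_0(A)P_0(B)\right);$$ (ii) for any measurable set $A\subset\Theta$, any $j,l\in\{1,\dots,d\}$ and any positive integers $n_j,n_l$ (exponents attached to $P_j$ and $P_l$ respectively), $$\mathbb E\left[P_j(A)^{n_j}P_l(A)^{n_l}\right]=\mathbb E\left[P_0(A)^{K_{(n_j,n_l)}}\right]=\sum_{k=1}^{n_j+n_l}P_0(A)^k\,\mathbb P\left(K_{(n_j,n_l)}=k\right).$$ Here $K_{(a,b)}$ is the global number of clusters (distinct values) across two samples of sizes $a$ and $b$ from $P_j$ and $P_l$, as defined in the context.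
   Context: Setting. $d\ge1$ is an integer, $\Theta\subset\mathbb R^s$ is a (Borel) parameter space, $P_0$ is a diffuse (non-atomic) probability measure on $\Theta$, $q_M$ is a probability mass function on $\{1,2,3,\dots\}$, and $H=H_1\times\dots\times H_d$, where $H_j(\mathrm ds)=h(s\mid\gamma_j)\,\mathrm ds$ are probability distributions on $(0,\infty)$ with densities from a common parametric family, with parameters $\gamma_j>0$. Let $M\sim q_M$; conditionally on $M$, let $S_{j,m}$ ($1\le j\le d$, $1\le m\le M$) be independent with $S_{j,m}\sim H_j$, and let $\tau_1,\dots,\tau_M$ be i.i.d. from $P_0$, independent of the $S_{j,m}$. Put $\mu_j=\sum_{m=1}^M S_{j,m}\delta_{\tau_m}$ and $P_j=\mu_j/\mu_j(\Theta)$. The law of $(P_1,\dots,P_d)$ is denoted $\text{Vec-NIFPP}(q_M,H,P_0)$. Number of clusters. For given $j,l$ and positive integers $a,b$, let $X_1,\dots,X_a,Y_1,\dots,Y_b$ be conditionally independent given $(P_1,\dots,P_d)$, with $X_i\sim P_j$ and $Y_i\sim P_l$. Then $K_{(a,b)}$ denotes the number of distinct values in $\{X_1,\dots,X_a,Y_1,\dots,Y_b\}$ (its law depends on $j,l$). When $j=l$ this is the number of distinct values among $a+b$ conditionally i.i.d. draws from $P_j$. *)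

theory Defs
  imports "HOL-Probability.Probability"
begin

text \<open>The law on \<open>(0, \<infinity>)\<close> with Lebesgue density \<open>s \<mapsto> h s g\<close>.
  Its space is \<open>(0, \<infinity>)\<close>, not the whole line, so that jumps drawn from it are positive
  everywhere, not just almost surely.\<close>

definition jump_law :: "(real \<Rightarrow> real \<Rightarrow> real) \<Rightarrow> real \<Rightarrow> real measure" where
  "jump_law h g = density (restrict_space lborel {0<..}) (\<lambda>s. ennreal (h s g))"

definition param_density_family :: "(real \<Rightarrow> real \<Rightarrow> real) \<Rightarrow> bool" where
  "param_density_family h \<longleftrightarrow>
     (\<forall>g>0. (\<lambda>s. h s g) \<in> borel_measurable (restrict_space lborel {0<..}) \<and>
            (\<forall>s>0. 0 \<le> h s g) \<and> prob_space (jump_law h g))"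

text \<open>The finite atomic measure \<open>\<Sum>m=1..M. s m \<cdot> \<delta>\<^bsub>t m\<^esub>\<close> on the measurable space of \<open>N\<close>
  (only \<open>space N\<close> and \<open>sets N\<close> are used).\<close>

definition atomic_measure ::
  "'a measure \<Rightarrow> nat \<Rightarrow> (nat \<Rightarrow> real) \<Rightarrow> (nat \<Rightarrow> 'a) \<Rightarrow> 'a measure" where
  "atomic_measure N M s t = measure_of (space N) (sets N)
     (\<lambda>A. \<Sum>m=1..M. ennreal (s m) * emeasure (return N (t m)) A)"

definition normalize_measure :: "'a measure \<Rightarrow> 'a measure" where
  "normalize_measure \<mu> = scale_measure (inverse (emeasure \<mu> (space \<mu>))) \<mu>"

definition vec_rpm_space :: "nat \<Rightarrow> 'a measure \<Rightarrow> (nat \<Rightarrow> 'a measure) measure" where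
  "vec_rpm_space d N = (\<Pi>\<^sub>M j\<in>{1..d}. prob_algebra N)"

text \<open>The joint law of \<open>(P\<^sub>1, \<dots>, P\<^sub>d)\<close>.  Given \<open>M\<close>, the jumps \<open>S (j, m)\<close> and the atoms \<open>\<tau> m\<close> are
  independent; the atoms are common to all \<open>j\<close>.\<close>

definition vec_nifpp ::
  "nat \<Rightarrow> nat pmf \<Rightarrow> (nat \<Rightarrow> real measure) \<Rightarrow> 'a measure \<Rightarrow> (nat \<Rightarrow> 'a measure) measure" where
  "vec_nifpp d q H P0 = measure_pmf q \<bind> (\<lambda>M.
     distr ((\<Pi>\<^sub>M (j, m)\<in>{1..d} \<times> {1..M}. H j) \<Otimes>\<^sub>M (\<Pi>\<^sub>M m\<in>{1..M}. P0))
       (vec_rpm_space d P0)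
       (\<lambda>(S, \<tau>). \<lambda>j\<in>{1..d}. normalize_measure (atomic_measure P0 M (\<lambda>m. S (j, m)) \<tau>)))"

text \<open>The joint law of \<open>X\<^sub>1, \<dots>, X\<^sub>a, Y\<^sub>1, \<dots>, Y\<^sub>b\<close> that are conditionally independent given a random
  vector \<open>p\<close> of probability measures with law \<open>V\<close>, where \<open>X\<^sub>i \<sim> p j\<close> and \<open>Y\<^sub>i \<sim> p l\<close>.\<close>

definition sample_law ::
  "(nat \<Rightarrow> 'a measure) measure \<Rightarrow> nat \<Rightarrow> nat \<Rightarrow> nat \<Rightarrow> nat \<Rightarrow> ((nat \<Rightarrow> 'a) \<times> (nat \<Rightarrow> 'a)) measure" where
  "sample_law V j l a b =
     V \<bind> (\<lambda>p. (\<Pi>\<^sub>M i\<in>{1..a}. p j) \<Otimes>\<^sub>M (\<Pi>\<^sub>M i\<in>{1..b}. p l))"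

definition num_clusters :: "nat \<Rightarrow> nat \<Rightarrow> (nat \<Rightarrow> 'a) \<times> (nat \<Rightarrow> 'a) \<Rightarrow> nat" where
  "num_clusters a b = (\<lambda>(X, Y). card (X ` {1..a} \<union> Y ` {1..b}))"

end

theory Submission
  imports Defs
begin

text \<open>
  Fix \<open>M\<close> and the jumps. Then \<open>P\<^sub>j\<close> is the image under \<open>\<tau>\<close> of a deterministic law on the labels
  \<open>{1..M}\<close>, so a sample from \<open>P\<^sub>j\<close> and \<open>P\<^sub>l\<close> is \<open>\<tau> \<circ> L\<close> with random labels \<open>L\<close> independent of \<open>\<tau>\<close>.
  Since \<open>P\<^sub>0\<close> is diffuse, the atoms are almost surely distinct and the number of clusters is the number
  of distinct labels; given \<open>L\<close>, the atoms carrying them are i.i.d. from \<open>P\<^sub>0\<close>. Hence, averaging over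
  \<open>\<tau>\<close> for fixed \<open>L\<close>, all observations fall in \<open>A\<close> with probability \<open>P\<^sub>0(A)\<close> to the number of clusters,
  and a pair falls in \<open>A \<times> B\<close> with probability \<open>P\<^sub>0(A \<inter> B)\<close> or \<open>P\<^sub>0(A) P\<^sub>0(B)\<close> according to whether its
  labels agree. The mean formula is the covariance formula with \<open>B = \<Theta>\<close>.
\<close>

section \<open>I.i.d. samples from images of discrete laws\<close>

text \<open>Drawing labels independently and then applying \<open>t\<close> coordinatewise gives the
  product of the image laws: both measures agree on boxes, and these determine a finite product
  measure. The default \<open>undefined\<close> of the labels outside \<open>I\<close> never shows,
  because the sample is restricted to \<open>I\<close>.\<close>

lemma nn_integral_PiM_distr_pmf:
  fixes w :: "'c pmf" and N :: "'a measure"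
  assumes I: "finite I" and t: "\<And>m. t m \<in> space N"
    and f: "f \<in> borel_measurable (\<Pi>\<^sub>M i\<in>I. N)"
  shows "(\<integral>\<^sup>+x. f x \<partial>(\<Pi>\<^sub>M i\<in>I. distr (measure_pmf w) N t))
    = (\<integral>\<^sup>+L. f (\<lambda>i\<in>I. t (L i)) \<partial>measure_pmf (Pi_pmf I undefined (\<lambda>_. w)))"
proof -
  define D where "D = distr (measure_pmf w) N t"
  have t_meas: "t \<in> measure_pmf w \<rightarrow>\<^sub>M N" using t by simp
  interpret D: prob_space D unfolding D_def
    by (rule prob_space.prob_space_distr[OF prob_space_measure_pmf t_meas])
  interpret product_prob_space "\<lambda>_. D" by unfold_locales
  let ?pi = "measure_pmf (Pi_pmf I undefined (\<lambda>_. w))"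
  have g_meas: "(\<lambda>L. \<lambda>i\<in>I. t (L i)) \<in> ?pi \<rightarrow>\<^sub>M (\<Pi>\<^sub>M i\<in>I. N)"
    using t by (auto simp: space_PiM)
  have sets_D [simp]: "sets D = sets N" by (simp add: D_def)
  have "distr ?pi (\<Pi>\<^sub>M i\<in>I. N) (\<lambda>L. \<lambda>i\<in>I. t (L i)) = (\<Pi>\<^sub>M i\<in>I. D)"
  proof (rule PiM_eqI[OF I])
    show "sets (distr ?pi (\<Pi>\<^sub>M i\<in>I. N) (\<lambda>L. \<lambda>i\<in>I. t (L i))) = sets (\<Pi>\<^sub>M i\<in>I. D)"
      by (simp cong: sets_PiM_cong)
    fix A :: "'b \<Rightarrow> 'a set" assume A: "\<And>i. i \<in> I \<Longrightarrow> A i \<in> sets D"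
    \<comment> \<open>The event that every coordinate hits its set becomes a product of
      one-coordinate functions, the form that \<open>nn_integral_prod_Pi_pmf\<close>
      factorizes.\<close>
    have ind: "(\<Prod>i\<in>I. indicator (t -` A i) (L i) :: ennreal)
        = indicator {L. \<forall>i\<in>I. t (L i) \<in> A i} L" for L
      using I by (cases "\<forall>i\<in>I. t (L i) \<in> A i") (auto simp: indicator_def intro!: prod_zero)
    have "emeasure (distr ?pi (\<Pi>\<^sub>M i\<in>I. N) (\<lambda>L. \<lambda>i\<in>I. t (L i))) (Pi\<^sub>E I A)
        = emeasure ?pi {L. \<forall>i\<in>I. t (L i) \<in> A i}"
      using A I by (subst emeasure_distr[OF g_meas])
        (auto intro!: arg_cong[where f="emeasure ?pi"] sets_PiM_I_finite)
    also have "\<dots> = (\<integral>\<^sup>+L. (\<Prod>i\<in>I. indicator (t -` A i) (L i)) \<partial>?pi)"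
      by (simp only: ind) simp
    also have "\<dots> = (\<Prod>i\<in>I. \<integral>\<^sup>+m. indicator (t -` A i) m \<partial>measure_pmf w)"
      by (rule nn_integral_prod_Pi_pmf[OF I])
    also have "\<dots> = (\<Prod>i\<in>I. emeasure D (A i))"
      using A by (intro prod.cong refl) (simp add: D_def emeasure_distr[OF t_meas])
    finally show "emeasure (distr ?pi (\<Pi>\<^sub>M i\<in>I. N) (\<lambda>L. \<lambda>i\<in>I. t (L i))) (Pi\<^sub>E I A)
        = (\<Prod>i\<in>I. emeasure D (A i))" .
  qed
  moreover have "f \<in> borel_measurable (distr ?pi (\<Pi>\<^sub>M i\<in>I. N) (\<lambda>L. \<lambda>i\<in>I. t (L i)))"
    using f by simp
  ultimately show ?thesis
    unfolding D_def[symmetric] using nn_integral_distr[OF g_meas, of f] by simp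
qed

section \<open>Finite atomic measures and their normalizations\<close>

text \<open>\<open>measure_of\<close> returns the prescribed values only if they form a measure.
  This is shown by recognizing them as the values of \<open>\<nu>\<close>, the image under
  \<open>t\<close> of a weighted point measure on the indices, which is a measure by
  construction.\<close>

lemma emeasure_atomic_measure:
  assumes t: "\<And>m. m \<in> {1..M} \<Longrightarrow> t m \<in> space N" and A: "A \<in> sets N"
  shows "emeasure (atomic_measure N M s t) A
    = (\<Sum>m=1..M. ennreal (s m) * indicator A (t m))"
proof -
  define \<nu> where "\<nu> = distr (point_measure {1..M} (\<lambda>m. ennreal (s m))) N t"
  have t_meas: "t \<in> point_measure {1..M} (\<lambda>m. ennreal (s m)) \<rightarrow>\<^sub>M N"
    using t by (auto simp: Pi_iff)
  have \<nu>: "emeasure \<nu> B = (\<Sum>m=1..M. ennreal (s m) * indicator B (t m))" if "B \<in> sets N" for B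
  proof -
    have "emeasure \<nu> B = (\<Sum>m\<in>t -` B \<inter> {1..M}. ennreal (s m))"
      unfolding \<nu>_def using that
      by (subst emeasure_distr[OF t_meas]) (auto simp: space_point_measure emeasure_point_measure_finite)
    also have "\<dots> = (\<Sum>m=1..M. ennreal (s m) * indicator B (t m))"
      by (rule sum.mono_neutral_cong_left) (auto simp: indicator_eq_0_iff)
    finally show ?thesis .
  qed
  have "(\<Sum>m=1..M. ennreal (s m) * emeasure (return N (t m)) B) = emeasure \<nu> B"
    if "B \<in> sets N" for B
    unfolding \<nu>[OF that] using that by (intro sum.cong) simp_all
  moreover have "space \<nu> = space N" "sets \<nu> = sets N" by (simp_all add: \<nu>_def)
  ultimately have "atomic_measure N M s t = measure_of (space \<nu>) (sets \<nu>) (emeasure \<nu>)"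
    unfolding atomic_measure_def
    by (simp only:) (intro measure_of_eq sets.space_closed, simp only: sets.sigma_sets_eq)
  then show ?thesis unfolding measure_of_of_measure by (simp only: \<nu>[OF A])
qed

lemma space_atomic_measure [simp]: "space (atomic_measure N M s t) = space N"
  by (simp add: atomic_measure_def space_measure_of_conv)

lemma sets_atomic_measure [simp]: "sets (atomic_measure N M s t) = sets N"
  by (simp add: atomic_measure_def sets.space_closed sets.sigma_sets_eq)

lemma sets_normalize_measure [simp]: "sets (normalize_measure \<mu>) = sets \<mu>"
  by (simp add: normalize_measure_def)

lemma emeasure_normalize_atomic_measure:
  assumes t: "\<And>m. m \<in> {1..M} \<Longrightarrow> t m \<in> space N" and A: "A \<in> sets N"
  shows "emeasure (normalize_measure (atomic_measure N M s t)) A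
    = inverse (\<Sum>m=1..M. ennreal (s m)) * (\<Sum>m=1..M. ennreal (s m) * indicator A (t m))"
proof -
  have "emeasure (atomic_measure N M s t) (space N) = (\<Sum>m=1..M. ennreal (s m))"
    using t by (subst emeasure_atomic_measure) auto
  then show ?thesis
    by (simp only: normalize_measure_def emeasure_scale_measure emeasure_atomic_measure[OF assms]
      space_atomic_measure)
qed

text \<open>The law of the index of the atom chosen by one draw from the normalized measure.
  \<open>embed_pmf\<close> is meaningful only for a nonnegative function of total mass one, which
  holds for positive weights and \<open>1 \<le> M\<close>.\<close>

definition weight_pmf :: "nat \<Rightarrow> (nat \<Rightarrow> real) \<Rightarrow> nat pmf" where
  "weight_pmf M s = embed_pmf (\<lambda>m. if m \<in> {1..M} then s m / (\<Sum>k=1..M. s k) else 0)"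

lemma
  assumes M: "1 \<le> M" and s: "\<And>m. m \<in> {1..M} \<Longrightarrow> 0 < s m"
  shows pmf_weight_pmf: "pmf (weight_pmf M s) m = (if m \<in> {1..M} then s m / (\<Sum>k=1..M. s k) else 0)"
    and set_weight_pmf: "set_pmf (weight_pmf M s) = {1..M}"
proof -
  define T where "T = (\<Sum>m=1..M. s m)"
  define g where "g m = (if m \<in> {1..M} then s m / T else 0)" for m
  have T: "0 < T" unfolding T_def using M s by (intro sum_pos) auto
  have g_nonneg: "0 \<le> g m" for m
    using s[of m] T by (auto simp: g_def intro!: divide_nonneg_pos less_imp_le)
  have "(\<integral>\<^sup>+m. ennreal (g m) \<partial>count_space UNIV) = (\<Sum>m=1..M. ennreal (g m))"
    by (rule nn_integral_count_space') (auto simp: g_def)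
  also have "\<dots> = ennreal (\<Sum>m=1..M. g m)"
    using g_nonneg by (intro sum_ennreal) auto
  also have "(\<Sum>m=1..M. g m) = 1"
    using T by (simp add: g_def T_def sum_divide_distrib[symmetric])
  finally have "(\<integral>\<^sup>+m. ennreal (g m) \<partial>count_space UNIV) = 1" by simp
  then have pmf_w: "pmf (weight_pmf M s) m = g m" for m
    unfolding weight_pmf_def T_def[symmetric] g_def[abs_def, symmetric]
    by (intro pmf_embed_pmf g_nonneg)
  then show "pmf (weight_pmf M s) m = (if m \<in> {1..M} then s m / (\<Sum>k=1..M. s k) else 0)"
    by (simp add: g_def T_def)
  have "s m \<noteq> 0" if "m \<in> {1..M}" for m using s[OF that] by simp
  then show "set_pmf (weight_pmf M s) = {1..M}"
    using T by (auto simp: set_pmf_eq pmf_w g_def)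
qed

text \<open>The atoms are clipped outside \<open>{1..M}\<close> because a product measure leaves them undefined there.\<close>

lemma normalize_atomic_measure_eq_distr:
  assumes M: "1 \<le> M" and s: "\<And>m. m \<in> {1..M} \<Longrightarrow> 0 < s m"
    and t: "\<And>m. m \<in> {1..M} \<Longrightarrow> t m \<in> space N"
  shows "normalize_measure (atomic_measure N M s t)
    = distr (measure_pmf (weight_pmf M s)) N (\<lambda>m. t (if m \<in> {1..M} then m else 1))"
proof (rule measure_eqI)
  let ?t = "\<lambda>m. t (if m \<in> {1..M} then m else 1)"
  define T where "T = (\<Sum>m=1..M. s m)"
  have T: "0 < T" unfolding T_def using M s by (intro sum_pos) auto
  have t_meas: "?t \<in> measure_pmf (weight_pmf M s) \<rightarrow>\<^sub>M N" using t M by auto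
  fix A assume "A \<in> sets (normalize_measure (atomic_measure N M s t))"
  then have A: "A \<in> sets N" by simp
  have "emeasure (distr (measure_pmf (weight_pmf M s)) N ?t) A
      = (\<integral>\<^sup>+m. indicator A (?t m) \<partial>measure_pmf (weight_pmf M s))"
    using A by (subst nn_integral_distr[OF t_meas, symmetric]) auto
  also have "\<dots> = (\<Sum>m=1..M. indicator A (?t m) * ennreal (pmf (weight_pmf M s) m))"
    by (subst nn_integral_measure_pmf_finite) (simp_all only: set_weight_pmf[OF M s] finite_atLeastAtMost zero_le)
  also have "\<dots> = (\<Sum>m=1..M. indicator A (t m) * ennreal (s m / T))"
    by (intro sum.cong refl) (simp only: pmf_weight_pmf[OF M s] T_def if_True)
  \<comment> \<open>Since \<open>T\<close> is positive, the real quotient becomes multiplication by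
    an inverse in the extended nonnegative reals, and the common factor can be pulled out.\<close>
  also have "\<dots> = inverse (ennreal T) * (\<Sum>m=1..M. ennreal (s m) * indicator A (t m))"
    unfolding sum_distrib_left using T s
    by (intro sum.cong refl)
      (auto simp: divide_ennreal[symmetric] divide_ennreal_def mult_ac less_imp_le)
  also have "ennreal T = (\<Sum>m=1..M. ennreal (s m))"
    unfolding T_def using s by (intro sum_ennreal[symmetric]) (auto intro: less_imp_le)
  finally show "emeasure (normalize_measure (atomic_measure N M s t)) A
      = emeasure (distr (measure_pmf (weight_pmf M s)) N ?t) A"
    by (simp only: emeasure_normalize_atomic_measure[OF t A])
qed simp

section \<open>Diffuse base measure: distinct atoms and measurable cluster counts\<close>

text \<open>The topological sort and \<open>borel_ident\<close> together make equality of two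
  observations a measurable event and singletons measurable sets. Both are needed to count distinct
  values.\<close>

locale diffuse_prob_space = prob_space P0
  for P0 :: "'a :: {second_countable_topology, t2_space} measure" +
  assumes borel_ident [measurable]: "(\<lambda>x. x) \<in> borel_measurable P0"
    and diffuse: "\<And>x. x \<in> space P0 \<Longrightarrow> emeasure P0 {x} = 0"
begin

sublocale atoms: product_prob_space "\<lambda>_. P0" I for I :: "nat set"
  by unfold_locales

abbreviation sample_space :: "nat \<Rightarrow> nat \<Rightarrow> ((nat \<Rightarrow> 'a) \<times> (nat \<Rightarrow> 'a)) measure" where
  "sample_space a b \<equiv> (\<Pi>\<^sub>M i\<in>{1..a}. P0) \<Otimes>\<^sub>M (\<Pi>\<^sub>M i\<in>{1..b}. P0)"

lemma borel_component: "i \<in> I \<Longrightarrow> (\<lambda>x. x i) \<in> borel_measurable (\<Pi>\<^sub>M i\<in>I. P0)"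
  using measurable_compose[OF measurable_component_singleton[of i I "\<lambda>_. P0"] borel_ident] by simp

text \<open>There are finitely many pairs of indices, so it suffices that two given atoms differ
  almost surely. With all other atoms fixed, a coincidence forces \<open>\<tau> m\<close> to hit the
  single point \<open>\<tau> n\<close>, which is null by diffuseness.\<close>

lemma AE_atoms_distinct:
  fixes I :: "nat set"
  assumes "finite I"
  shows "AE \<tau> in (\<Pi>\<^sub>M i\<in>I. P0). inj_on \<tau> I"
proof -
  have "AE \<tau> in (\<Pi>\<^sub>M i\<in>I. P0). \<tau> m \<noteq> \<tau> n" if mn: "m \<in> I" "n \<in> I" "m \<noteq> n" for m n :: nat
  proof -
    define J where "J = I - {m}"
    have I: "I = insert m J" "finite J" "m \<notin> J" "n \<in> J"
      using mn assms by (auto simp: J_def)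
    let ?E = "{\<tau> \<in> space (\<Pi>\<^sub>M i\<in>I. P0). \<tau> m = \<tau> n}"
    have E: "?E \<in> sets (\<Pi>\<^sub>M i\<in>I. P0)"
      using borel_component[OF mn(1)] borel_component[OF mn(2)] by measurable
    have "emeasure (\<Pi>\<^sub>M i\<in>I. P0) ?E = (\<integral>\<^sup>+\<tau>. indicator ?E \<tau> \<partial>(\<Pi>\<^sub>M i\<in>insert m J. P0))"
      using E by (simp add: I(1))
    \<comment> \<open>Fubini: coordinate \<open>m\<close> is integrated first, and \<open>n\<close>
      remains in \<open>J\<close>, so \<open>\<tau> n\<close> is a constant of the inner
      integral.\<close>
    also have "\<dots> = (\<integral>\<^sup>+\<tau>. \<integral>\<^sup>+y. indicator ?E (\<tau>(m := y)) \<partial>P0 \<partial>(\<Pi>\<^sub>M i\<in>J. P0))"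
      using E by (intro atoms.product_nn_integral_insert I) (simp add: I(1))
    also have "\<dots> = (\<integral>\<^sup>+\<tau>. \<integral>\<^sup>+y. indicator {\<tau> n} y \<partial>P0 \<partial>(\<Pi>\<^sub>M i\<in>J. P0))"
      using I by (intro nn_integral_cong)
        (auto simp: indicator_def space_PiM PiE_iff extensional_def)
    also have "\<dots> = (\<integral>\<^sup>+\<tau>. 0 \<partial>(\<Pi>\<^sub>M i\<in>J. P0))"
    proof (intro nn_integral_cong)
      fix \<tau> assume "\<tau> \<in> space (\<Pi>\<^sub>M i\<in>J. P0)"
      then have x: "\<tau> n \<in> space P0" using I by (auto simp: space_PiM)
      have "{x \<in> space P0. x = \<tau> n} \<in> sets P0" by measurable
      also have "{x \<in> space P0. x = \<tau> n} = {\<tau> n}" using x by auto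
      finally show "(\<integral>\<^sup>+y. indicator {\<tau> n} y \<partial>P0) = 0" using diffuse[OF x] by simp
    qed
    finally show ?thesis using E by (subst AE_iff_measurable[OF E]) auto
  qed
  then have "AE \<tau> in (\<Pi>\<^sub>M i\<in>I. P0). \<forall>m\<in>I. \<forall>n\<in>I. m \<noteq> n \<longrightarrow> \<tau> m \<noteq> \<tau> n"
    using assms by (auto simp: AE_ball_countable countable_finite)
  then show ?thesis by (rule AE_mp) (auto intro!: AE_I2 simp: inj_on_def)
qed

text \<open>The observations are added one at a time, first those of \<open>X\<close>, then those of
  \<open>Y\<close>. Each raises the cardinality by one unless it equals an earlier observation, and
  this is a finite disjunction of measurable equality events.\<close>

lemma measurable_num_clusters [measurable]:
  "num_clusters a b \<in> sample_space a b \<rightarrow>\<^sub>M count_space UNIV"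
proof -
  let ?S = "sample_space a b"
  have X: "(\<lambda>z. fst z i) \<in> borel_measurable ?S" if "i \<in> {1..a}" for i
    by (rule measurable_compose[OF measurable_fst borel_component[OF that]])
  have Y: "(\<lambda>z. snd z i) \<in> borel_measurable ?S" if "i \<in> {1..b}" for i
    by (rule measurable_compose[OF measurable_snd borel_component[OF that]])
  have inc: "card (insert x B) = card B + (if x \<in> B then 0 else 1)" if "finite B" for x and B :: "'a set"
    using that by (simp add: insert_absorb)
  have XX: "(\<lambda>z. if \<exists>k\<in>{1..m}. fst z (Suc m) = fst z k then 0 else 1 :: nat) \<in> ?S \<rightarrow>\<^sub>M count_space UNIV"
    if m: "Suc m \<le> a" for m
  proof -
    have "(\<lambda>z. fst z (Suc m) = fst z k) \<in> ?S \<rightarrow>\<^sub>M count_space UNIV" if "k \<in> {1..m}" for k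
      using m that X[of "Suc m"] X[of k] by (auto simp: pred_def)
    then have "Measurable.pred ?S (\<lambda>z. \<exists>k\<in>{1..m}. fst z (Suc m) = fst z k)"
      by (intro pred_intros_finite(4)) auto
    then show ?thesis by measurable
  qed
  have YY: "(\<lambda>z. if (\<exists>k\<in>{1..a}. snd z (Suc m) = fst z k) \<or> (\<exists>k\<in>{1..m}. snd z (Suc m) = snd z k)
      then 0 else 1 :: nat) \<in> ?S \<rightarrow>\<^sub>M count_space UNIV"
    if m: "Suc m \<le> b" for m
  proof -
    have "Measurable.pred ?S (\<lambda>z. snd z (Suc m) = fst z k)" if "k \<in> {1..a}" for k
      using m that Y[of "Suc m"] X[of k] by (auto simp: pred_def)
    then have 1: "Measurable.pred ?S (\<lambda>z. \<exists>k\<in>{1..a}. snd z (Suc m) = fst z k)"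
      by (intro pred_intros_finite(4)) auto
    have "Measurable.pred ?S (\<lambda>z. snd z (Suc m) = snd z k)" if "k \<in> {1..m}" for k
      using m that Y[of "Suc m"] Y[of k] by (auto simp: pred_def)
    then have 2: "Measurable.pred ?S (\<lambda>z. \<exists>k\<in>{1..m}. snd z (Suc m) = snd z k)"
      by (intro pred_intros_finite(4)) auto
    show ?thesis using 1 2 by measurable
  qed
  have A: "(\<lambda>z. card (fst z ` {1..m})) \<in> ?S \<rightarrow>\<^sub>M count_space UNIV" if "m \<le> a" for m
    using that
  proof (induction m)
    case (Suc m)
    have "(\<lambda>z :: (nat \<Rightarrow> 'a) \<times> (nat \<Rightarrow> 'a). card (fst z ` {1..Suc m})) = (\<lambda>z. card (fst z ` {1..m})
      + (if \<exists>k\<in>{1..m}. fst z (Suc m) = fst z k then 0 else 1))"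
      by (rule ext) (simp add: atLeastAtMostSuc_conv inc image_iff)
    then show ?case using Suc XX[of m] by simp
  qed simp
  have B: "(\<lambda>z. card (fst z ` {1..a} \<union> snd z ` {1..m})) \<in> ?S \<rightarrow>\<^sub>M count_space UNIV" if "m \<le> b" for m
    using that
  proof (induction m)
    case (Suc m)
    have "(\<lambda>z :: (nat \<Rightarrow> 'a) \<times> (nat \<Rightarrow> 'a). card (fst z ` {1..a} \<union> snd z ` {1..Suc m}))
      = (\<lambda>z. card (fst z ` {1..a} \<union> snd z ` {1..m})
      + (if (\<exists>k\<in>{1..a}. snd z (Suc m) = fst z k) \<or> (\<exists>k\<in>{1..m}. snd z (Suc m) = snd z k) then 0 else 1))"
      by (rule ext) (simp add: atLeastAtMostSuc_conv inc image_iff)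
    then show ?case using Suc YY[of m] by simp
  qed (use A in simp)
  show ?thesis using B[of b] by (simp add: num_clusters_def case_prod_beta')
qed

end

section \<open>Product kernels and auxiliary facts on probability measures\<close>

text \<open>Boxes form an intersection-stable generator, so measurability of the kernel need only be
  checked on them. There the product measure is a finite product of measurable functions of
  \<open>x\<close>.\<close>

lemma measurable_PiM_prob_algebra:
  assumes I: "finite I" and K: "K \<in> M \<rightarrow>\<^sub>M prob_algebra N"
  shows "(\<lambda>x. \<Pi>\<^sub>M i\<in>I. K x) \<in> M \<rightarrow>\<^sub>M prob_algebra (\<Pi>\<^sub>M i\<in>I. N)"
proof (rule measurable_prob_algebra_generated[OF sets_PiM Int_stable_prod_algebra prod_algebra_sets_into_space])
  have K_prob: "prob_space (K x)" "sets (K x) = sets N" if "x \<in> space M" for x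
    using measurable_space[OF K that] by (auto simp: space_prob_algebra)
  fix x assume x: "x \<in> space M"
  show "prob_space (\<Pi>\<^sub>M i\<in>I. K x)" by (intro prob_space_PiM K_prob x)
  show "sets (\<Pi>\<^sub>M i\<in>I. K x) = sets (\<Pi>\<^sub>M i\<in>I. N)" by (intro sets_PiM_cong K_prob x refl)
next
  fix A assume "A \<in> prod_algebra I (\<lambda>_. N)"
  then obtain X where X: "A = Pi\<^sub>E I X" "\<And>i. i \<in> I \<Longrightarrow> X i \<in> sets N"
    using I by (auto simp: prod_algebra_eq_finite)
  have "emeasure (\<Pi>\<^sub>M i\<in>I. K x) A = (\<Prod>i\<in>I. emeasure (K x) (X i))" if x: "x \<in> space M" for x
  proof -
    interpret K: prob_space "K x"
      using measurable_space[OF K x] by (simp add: space_prob_algebra)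
    interpret product_prob_space "\<lambda>_. K x" by unfold_locales
    have "sets (K x) = sets N"
      using measurable_space[OF K x] by (simp add: space_prob_algebra)
    then show ?thesis using X I by (simp add: emeasure_PiM)
  qed
  moreover have "(\<lambda>x. emeasure (K x) (X i)) \<in> borel_measurable M" if "i \<in> I" for i
    using measurable_prob_algebraD[OF K] X(2)[OF that] by measurable
  ultimately show "(\<lambda>x. emeasure (\<Pi>\<^sub>M i\<in>I. K x) A) \<in> borel_measurable M"
    by (simp cong: measurable_cong)
qed

lemma prob_space_normalize_atomic_measure:
  assumes "1 \<le> M" "\<And>m. m \<in> {1..M} \<Longrightarrow> 0 < s m" "\<And>m. m \<in> {1..M} \<Longrightarrow> t m \<in> space N"
  shows "prob_space (normalize_measure (atomic_measure N M s t))"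
  by (subst normalize_atomic_measure_eq_distr)
    (use assms in \<open>auto intro!: prob_space.prob_space_distr[OF prob_space_measure_pmf]\<close>)

text \<open>For an arbitrary map \<open>f\<close>, the total mass of \<open>distr\<close> is either
  the mass of a preimage or, if the prescribed values do not form a measure, zero. This handles the
  degenerate index \<open>M = 0\<close> of the mixture.\<close>

lemma subprob_space_distr_any:
  assumes M: "subprob_space M" and N: "space N \<noteq> {}"
  shows "subprob_space (distr M N f)"
proof (rule subprob_spaceI)
  interpret subprob_space M by (rule M)
  show "emeasure (distr M N f) (space (distr M N f)) \<le> 1"
    by (simp add: distr_def emeasure_measure_of_conv subprob_emeasure_le_1)
qed (simp add: N)

lemma (in prob_space) expectation_const_plus_indicator:
  assumes "E \<in> events"
  shows "expectation (\<lambda>z. c + indicator E z * e) = c + prob E * (e :: real)"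
  using assms by (subst Bochner_Integration.integral_add) (simp_all add: prob_space emeasure_eq_measure)

section \<open>The model and the measurability of its kernels\<close>

text \<open>\<open>sets_jump\<close> forces the space of \<open>H j\<close> to be the open half
  line, so jumps are positive at every sample point and no null sets of jumps have to be tracked.
  \<open>no_zero\<close> expresses that \<open>q\<close> lives on the positive integers.\<close>

locale nifpp = diffuse_prob_space P0
  for P0 :: "'a :: {second_countable_topology, t2_space} measure" +
  fixes d :: nat and q :: "nat pmf" and H :: "nat \<Rightarrow> real measure"
  assumes prob_jump: "\<And>j. j \<in> {1..d} \<Longrightarrow> prob_space (H j)"
    and sets_jump: "\<And>j. j \<in> {1..d} \<Longrightarrow> sets (H j) = sets (restrict_space borel {0<..})"
    and no_zero: "pmf q 0 = 0"
begin

abbreviation jump_space :: "nat \<Rightarrow> (nat \<times> nat \<Rightarrow> real) measure" where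
  "jump_space M \<equiv> \<Pi>\<^sub>M (j, m)\<in>{1..d} \<times> {1..M}. H j"

abbreviation atom_space :: "nat \<Rightarrow> (nat \<Rightarrow> 'a) measure" where
  "atom_space M \<equiv> \<Pi>\<^sub>M m\<in>{1..M}. P0"

text \<open>The map pushed forward in \<open>vec_nifpp\<close>, named so that it can be composed
  with the sampling kernel.\<close>

definition random_vec :: "nat \<Rightarrow> (nat \<times> nat \<Rightarrow> real) \<times> (nat \<Rightarrow> 'a) \<Rightarrow> nat \<Rightarrow> 'a measure" where
  "random_vec M = (\<lambda>(S, \<tau>). \<lambda>j\<in>{1..d}. normalize_measure (atomic_measure P0 M (\<lambda>m. S (j, m)) \<tau>))"

definition sample_kernel :: "nat \<Rightarrow> nat \<Rightarrow> nat \<Rightarrow> nat \<Rightarrow> (nat \<Rightarrow> 'a measure)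
    \<Rightarrow> ((nat \<Rightarrow> 'a) \<times> (nat \<Rightarrow> 'a)) measure" where
  "sample_kernel j l a b p = (\<Pi>\<^sub>M i\<in>{1..a}. p j) \<Otimes>\<^sub>M (\<Pi>\<^sub>M i\<in>{1..b}. p l)"

lemma prob_space_jump_space: "prob_space (jump_space M)"
  by (rule prob_space_PiM) (auto intro: prob_jump)

lemma prob_space_atom_space: "prob_space (atom_space M)"
  by (rule prob_space_PiM) unfold_locales

lemma jump_pos:
  assumes "S \<in> space (jump_space M)" "j \<in> {1..d}" "m \<in> {1..M}"
  shows "0 < S (j, m)"
proof -
  have "S (j, m) \<in> space (H j)" using assms by (auto simp: space_PiM PiE_iff)
  also have "space (H j) = {0<..}"
    using sets_eq_imp_space_eq[OF sets_jump[OF assms(2)]] by (simp add: space_restrict_space)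
  finally show ?thesis by simp
qed

lemma measurable_jump:
  assumes "j \<in> {1..d}" "m \<in> {1..M}"
  shows "(\<lambda>z. fst z (j, m)) \<in> borel_measurable (jump_space M \<Otimes>\<^sub>M atom_space M)"
proof -
  have "(\<lambda>x. x) \<in> borel_measurable (H j)"
    unfolding measurable_cong_sets[OF sets_jump[OF assms(1)] refl]
    by (intro measurable_restrict_space1) simp
  moreover have "(\<lambda>S. S (j, m)) \<in> jump_space M \<rightarrow>\<^sub>M H j"
    using measurable_component_singleton[of "(j, m)" "{1..d} \<times> {1..M}" "\<lambda>(j, m). H j"] assms by simp
  ultimately show ?thesis
    by (intro measurable_compose[OF measurable_fst]) (rule measurable_compose)
qed

text \<open>Each component is a probability measure since \<open>1 \<le> M\<close> and the jumps are
  positive. Its evaluation at a set is an explicit ratio of sums of measurable functions, and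
  evaluations generate the sigma-algebra on measures.\<close>

lemma measurable_random_vec:
  assumes M: "1 \<le> M"
  shows "random_vec M \<in> jump_space M \<Otimes>\<^sub>M atom_space M \<rightarrow>\<^sub>M vec_rpm_space d P0"
proof -
  have eq: "random_vec M = (\<lambda>z. \<lambda>j\<in>{1..d}.
      normalize_measure (atomic_measure P0 M (\<lambda>m. fst z (j, m)) (snd z)))"
    by (simp add: random_vec_def fun_eq_iff split_beta)
  show ?thesis
    unfolding eq vec_rpm_space_def
  proof (rule measurable_restrict, rule measurable_prob_algebraI)
    fix j assume j: "j \<in> {1..d}"
    let ?R = "\<lambda>z :: (nat \<times> nat \<Rightarrow> real) \<times> (nat \<Rightarrow> 'a).
      normalize_measure (atomic_measure P0 M (\<lambda>m. fst z (j, m)) (snd z))"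
    have atom: "snd z m \<in> space P0" if "z \<in> space (jump_space M \<Otimes>\<^sub>M atom_space M)" "m \<in> {1..M}" for z m
      using that by (auto simp: space_pair_measure space_PiM)
    show prob: "prob_space (?R z)" if z: "z \<in> space (jump_space M \<Otimes>\<^sub>M atom_space M)" for z
      using z by (intro prob_space_normalize_atomic_measure M atom jump_pos[OF _ j])
        (auto simp: space_pair_measure)
    show "?R \<in> jump_space M \<Otimes>\<^sub>M atom_space M \<rightarrow>\<^sub>M subprob_algebra P0"
    proof (rule measurable_subprob_algebra)
      fix A assume A: "A \<in> sets P0"
      have S: "(\<lambda>z. ennreal (fst z (j, m))) \<in> borel_measurable (jump_space M \<Otimes>\<^sub>M atom_space M)"
        if "m \<in> {1..M}" for m
        using measurable_jump[OF j that] by measurable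
      have T: "(\<lambda>z. indicator A (snd z m) :: ennreal) \<in> borel_measurable (jump_space M \<Otimes>\<^sub>M atom_space M)"
        if "m \<in> {1..M}" for m
        by (intro measurable_compose[OF measurable_snd] borel_measurable_indicator
            measurable_compose[OF measurable_component_singleton[OF that]] A)
      have "(\<lambda>z. inverse (\<Sum>m=1..M. ennreal (fst z (j, m)))
          * (\<Sum>m=1..M. ennreal (fst z (j, m)) * indicator A (snd z m)))
          \<in> borel_measurable (jump_space M \<Otimes>\<^sub>M atom_space M)"
        using S T by (intro borel_measurable_times_ennreal borel_measurable_inverse_ennreal
            borel_measurable_sum) auto
      moreover have "emeasure (?R z) A = inverse (\<Sum>m=1..M. ennreal (fst z (j, m)))
          * (\<Sum>m=1..M. ennreal (fst z (j, m)) * indicator A (snd z m))"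
        if "z \<in> space (jump_space M \<Otimes>\<^sub>M atom_space M)" for z
        by (rule emeasure_normalize_atomic_measure[OF atom[OF that] A])
      ultimately show "(\<lambda>z. emeasure (?R z) A) \<in> borel_measurable (jump_space M \<Otimes>\<^sub>M atom_space M)"
        by (subst measurable_cong)
    qed (blast intro: prob_space_imp_subprob_space prob, simp)
  qed
qed

lemma measurable_sample_kernel:
  assumes "j \<in> {1..d}" "l \<in> {1..d}"
  shows "sample_kernel j l a b \<in> vec_rpm_space d P0 \<rightarrow>\<^sub>M prob_algebra (sample_space a b)"
  unfolding sample_kernel_def[abs_def] vec_rpm_space_def
  by (intro measurable_pair_prob measurable_PiM_prob_algebra measurable_component_singleton assms
      finite_atLeastAtMost)

section \<open>Representation of samples by labels\<close>

text \<open>Given the jumps, these are the indices of the atoms picked by \<open>a\<close>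
  independent draws from component \<open>j\<close>. The atoms \<open>\<tau>\<close> do not
  enter.\<close>

definition label_pmf :: "nat \<Rightarrow> (nat \<times> nat \<Rightarrow> real) \<Rightarrow> nat \<Rightarrow> nat \<Rightarrow> (nat \<Rightarrow> nat) pmf" where
  "label_pmf M S j a = Pi_pmf {1..a} undefined (\<lambda>_. weight_pmf M (\<lambda>m. S (j, m)))"

lemma
  assumes "1 \<le> M" "S \<in> space (jump_space M)" "j \<in> {1..d}"
  shows finite_set_label_pmf: "finite (set_pmf (label_pmf M S j a))"
    and label_in_range: "L \<in> set_pmf (label_pmf M S j a) \<Longrightarrow> i \<in> {1..a} \<Longrightarrow> L i \<in> {1..M}"
proof -
  have *: "set_pmf (label_pmf M S j a) = PiE_dflt {1..a} undefined (\<lambda>_. {1..M})"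
    using set_weight_pmf[OF assms(1) jump_pos[OF assms(2,3)]]
    by (simp add: label_pmf_def set_Pi_pmf comp_def)
  show "finite (set_pmf (label_pmf M S j a))"
    unfolding * by (intro finite_PiE_dflt finite_atLeastAtMost)
  show "L \<in> set_pmf (label_pmf M S j a) \<Longrightarrow> i \<in> {1..a} \<Longrightarrow> L i \<in> {1..M}"
    unfolding * PiE_dflt_def by blast
qed

text \<open>For given \<open>\<tau>\<close>, both samples are \<open>\<tau>\<close> composed with
  independent labels. The law of the labels depends on the jumps only, so the average over
  \<open>\<tau>\<close> can be taken first, for each fixed labelling.\<close>

lemma nn_integral_sample_kernel_mixture:
  assumes M: "1 \<le> M" and S: "S \<in> space (jump_space M)"
    and j: "j \<in> {1..d}" and l: "l \<in> {1..d}"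
    and f: "f \<in> borel_measurable (sample_space a b)"
  shows "(\<integral>\<^sup>+\<tau>. \<integral>\<^sup>+z. f z \<partial>sample_kernel j l a b (random_vec M (S, \<tau>)) \<partial>atom_space M)
      = (\<integral>\<^sup>+L. \<integral>\<^sup>+L'. \<integral>\<^sup>+\<tau>. f (\<lambda>i\<in>{1..a}. \<tau> (L i), \<lambda>i\<in>{1..b}. \<tau> (L' i)) \<partial>atom_space M
          \<partial>measure_pmf (label_pmf M S l b) \<partial>measure_pmf (label_pmf M S j a))"
proof -
  let ?v = "weight_pmf M (\<lambda>m. S (j, m))" and ?w = "weight_pmf M (\<lambda>m. S (l, m))"
  let ?V = "label_pmf M S j a" and ?W = "label_pmf M S l b"
  note V = finite_set_label_pmf[OF M S j, of a] label_in_range[OF M S j, of _ a]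
  note W = finite_set_label_pmf[OF M S l, of b] label_in_range[OF M S l, of _ b]
  have inner: "(\<integral>\<^sup>+z. f z \<partial>sample_kernel j l a b (random_vec M (S, \<tau>)))
      = (\<integral>\<^sup>+L. \<integral>\<^sup>+L'. f (\<lambda>i\<in>{1..a}. \<tau> (L i), \<lambda>i\<in>{1..b}. \<tau> (L' i)) \<partial>?W \<partial>?V)"
    if \<tau>: "\<tau> \<in> space (atom_space M)" for \<tau>
  proof -
    \<comment> \<open>Clipping makes all values of \<open>t\<close> lie in \<open>space P0\<close>,
      as the label representation requires, and matches the form of
      \<open>normalize_atomic_measure_eq_distr\<close>.\<close>
    define t where "t m = \<tau> (if m \<in> {1..M} then m else 1)" for m
    have \<tau>m: "\<tau> m \<in> space P0" if "m \<in> {1..M}" for m using \<tau> that by (auto simp: space_PiM)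
    then have t: "t m \<in> space P0" for m using M by (auto simp: t_def)
    have t_meas: "t \<in> measure_pmf p \<rightarrow>\<^sub>M P0" for p using t by auto
    let ?Dv = "distr (measure_pmf ?v) P0 t" and ?Dw = "distr (measure_pmf ?w) P0 t"
    have ker: "sample_kernel j l a b (random_vec M (S, \<tau>)) = (\<Pi>\<^sub>M i\<in>{1..a}. ?Dv) \<Otimes>\<^sub>M (\<Pi>\<^sub>M i\<in>{1..b}. ?Dw)"
      using j l normalize_atomic_measure_eq_distr[OF M jump_pos[OF S j] \<tau>m]
        normalize_atomic_measure_eq_distr[OF M jump_pos[OF S l] \<tau>m]
      by (simp add: sample_kernel_def random_vec_def t_def[abs_def])
    interpret w: prob_space "\<Pi>\<^sub>M i\<in>{1..b}. ?Dw"
      by (intro prob_space_PiM prob_space.prob_space_distr[OF prob_space_measure_pmf t_meas])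
    have sets_Dv: "sets (\<Pi>\<^sub>M i\<in>{1..a}. ?Dv) = sets (\<Pi>\<^sub>M i\<in>{1..a}. P0)"
      and sets_Dw: "sets (\<Pi>\<^sub>M i\<in>{1..b}. ?Dw) = sets (\<Pi>\<^sub>M i\<in>{1..b}. P0)"
      by (intro sets_PiM_cong; simp)+
    have f': "f \<in> borel_measurable ((\<Pi>\<^sub>M i\<in>{1..a}. ?Dv) \<Otimes>\<^sub>M (\<Pi>\<^sub>M i\<in>{1..b}. ?Dw))"
      using f by (simp add: measurable_cong_sets[OF sets_pair_measure_cong[OF sets_Dv sets_Dw] refl])
    have "(\<integral>\<^sup>+z. f z \<partial>sample_kernel j l a b (random_vec M (S, \<tau>)))
        = (\<integral>\<^sup>+x. \<integral>\<^sup>+y. f (x, y) \<partial>(\<Pi>\<^sub>M i\<in>{1..b}. ?Dw) \<partial>(\<Pi>\<^sub>M i\<in>{1..a}. ?Dv))"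
      unfolding ker by (rule w.nn_integral_fst[OF f', symmetric])
    also have "\<dots> = (\<integral>\<^sup>+L. \<integral>\<^sup>+y. f (\<lambda>i\<in>{1..a}. t (L i), y) \<partial>(\<Pi>\<^sub>M i\<in>{1..b}. ?Dw) \<partial>?V)"
      using w.borel_measurable_nn_integral_fst[OF f']
      by (unfold label_pmf_def, intro nn_integral_PiM_distr_pmf finite_atLeastAtMost t)
        (simp_all add: measurable_cong_sets[OF sets_Dv refl])
    also have "\<dots> = (\<integral>\<^sup>+L. \<integral>\<^sup>+L'. f (\<lambda>i\<in>{1..a}. t (L i), \<lambda>i\<in>{1..b}. t (L' i)) \<partial>?W \<partial>?V)"
      using f t by (unfold label_pmf_def, intro nn_integral_cong nn_integral_PiM_distr_pmf finite_atLeastAtMost t)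
        (auto intro!: measurable_compose[OF measurable_Pair1'] simp: space_PiM)
    \<comment> \<open>The labels lie in \<open>{1..M}\<close> almost surely, so the clipping can be
      removed.\<close>
    also have "\<dots> = (\<integral>\<^sup>+L. \<integral>\<^sup>+L'. f (\<lambda>i\<in>{1..a}. \<tau> (L i), \<lambda>i\<in>{1..b}. \<tau> (L' i)) \<partial>?W \<partial>?V)"
      using V(2) W(2)
      by (intro nn_integral_cong_AE AE_pmfI arg_cong[where f=f] arg_cong2[where f=Pair] restrict_ext)
        (auto simp: t_def)
    finally show ?thesis .
  qed
  define F where "F L L' \<tau> = f (\<lambda>i\<in>{1..a}. \<tau> (L i), \<lambda>i\<in>{1..b}. \<tau> (L' i))" for L L' :: "nat \<Rightarrow> nat" and \<tau>
  \<comment> \<open>Restricting to labels in the supports keeps every index within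
    \<open>{1..M}\<close>, where evaluation of \<open>\<tau>\<close> is a coordinate map.\<close>
  have meas: "F L L' \<in> borel_measurable (atom_space M)"
    if "L \<in> set_pmf ?V" "L' \<in> set_pmf ?W" for L L'
    unfolding F_def[abs_def] using that V(2) W(2)
    by (intro measurable_compose[OF _ f] measurable_Pair measurable_restrict
        measurable_component_singleton) auto
  have "(\<integral>\<^sup>+\<tau>. \<integral>\<^sup>+z. f z \<partial>sample_kernel j l a b (random_vec M (S, \<tau>)) \<partial>atom_space M)
      = (\<integral>\<^sup>+\<tau>. (\<Sum>L\<in>set_pmf ?V. (\<Sum>L'\<in>set_pmf ?W. F L L' \<tau> * pmf ?W L') * pmf ?V L) \<partial>atom_space M)"
    by (intro nn_integral_cong)
      (simp only: inner F_def nn_integral_measure_pmf_finite[OF V(1)] nn_integral_measure_pmf_finite[OF W(1)] zero_le)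
  \<comment> \<open>Both label laws have finite support, so the exchange of integrals reduces to
    linearity over finite sums.\<close>
  also have "\<dots> = (\<Sum>L\<in>set_pmf ?V. \<integral>\<^sup>+\<tau>. (\<Sum>L'\<in>set_pmf ?W. F L L' \<tau> * pmf ?W L') * pmf ?V L \<partial>atom_space M)"
    by (intro nn_integral_sum borel_measurable_times_ennreal borel_measurable_sum meas borel_measurable_const)
  also have "\<dots> = (\<Sum>L\<in>set_pmf ?V. (\<Sum>L'\<in>set_pmf ?W. (\<integral>\<^sup>+\<tau>. F L L' \<tau> \<partial>atom_space M) * pmf ?W L') * pmf ?V L)"
  proof (rule sum.cong[OF refl])
    fix L assume L: "L \<in> set_pmf ?V"
    have "(\<integral>\<^sup>+\<tau>. (\<Sum>L'\<in>set_pmf ?W. F L L' \<tau> * pmf ?W L') * pmf ?V L \<partial>atom_space M)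
        = (\<integral>\<^sup>+\<tau>. (\<Sum>L'\<in>set_pmf ?W. F L L' \<tau> * pmf ?W L') \<partial>atom_space M) * pmf ?V L"
      by (intro nn_integral_multc borel_measurable_times_ennreal borel_measurable_sum
          borel_measurable_const meas[OF L])
    also have "(\<integral>\<^sup>+\<tau>. (\<Sum>L'\<in>set_pmf ?W. F L L' \<tau> * pmf ?W L') \<partial>atom_space M)
        = (\<Sum>L'\<in>set_pmf ?W. \<integral>\<^sup>+\<tau>. F L L' \<tau> * pmf ?W L' \<partial>atom_space M)"
      by (intro nn_integral_sum borel_measurable_times_ennreal borel_measurable_const meas[OF L])
    also have "\<dots> = (\<Sum>L'\<in>set_pmf ?W. (\<integral>\<^sup>+\<tau>. F L L' \<tau> \<partial>atom_space M) * pmf ?W L')"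
      by (intro sum.cong refl nn_integral_multc meas[OF L])
    finally show "(\<integral>\<^sup>+\<tau>. (\<Sum>L'\<in>set_pmf ?W. F L L' \<tau> * pmf ?W L') * pmf ?V L \<partial>atom_space M)
        = (\<Sum>L'\<in>set_pmf ?W. (\<integral>\<^sup>+\<tau>. F L L' \<tau> \<partial>atom_space M) * pmf ?W L') * pmf ?V L" .
  qed
  also have "\<dots> = (\<integral>\<^sup>+L. \<integral>\<^sup>+L'. \<integral>\<^sup>+\<tau>. F L L' \<tau> \<partial>atom_space M \<partial>?W \<partial>?V)"
    by (simp only: nn_integral_measure_pmf_finite[OF V(1)] nn_integral_measure_pmf_finite[OF W(1)] zero_le)
  finally show ?thesis unfolding F_def .
qed

section \<open>The law of the random vector\<close>

abbreviation V :: "(nat \<Rightarrow> 'a measure) measure" where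
  "V \<equiv> vec_nifpp d q H P0"

text \<open>For \<open>M = 0\<close> the normalized vector consists of null measures, so \<open>random_vec 0\<close> does not map into
  \<open>vec_rpm_space d P0\<close>; its \<open>distr\<close> is nevertheless a subprobability measure.\<close>

lemma vec_kernel_in_subprob:
  "(\<lambda>M. distr (jump_space M \<Otimes>\<^sub>M atom_space M) (vec_rpm_space d P0) (random_vec M))
    \<in> measure_pmf q \<rightarrow>\<^sub>M subprob_algebra (vec_rpm_space d P0)"
proof -
  have "(\<lambda>j\<in>{1..d}. P0) \<in> space (vec_rpm_space d P0)"
    using prob_space_axioms by (auto simp: vec_rpm_space_def space_PiM space_prob_algebra)
  then have ne: "space (vec_rpm_space d P0) \<noteq> {}" by blast
  have "subprob_space (jump_space M \<Otimes>\<^sub>M atom_space M)" for M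
    by (intro prob_space_imp_subprob_space prob_space_pair prob_space_jump_space prob_space_atom_space)
  then show ?thesis
    by (simp add: space_subprob_algebra subprob_space_distr_any[OF _ ne])
qed

lemma vec_nifpp_eq:
  "V = measure_pmf q \<bind> (\<lambda>M. distr (jump_space M \<Otimes>\<^sub>M atom_space M) (vec_rpm_space d P0) (random_vec M))"
  by (simp add: vec_nifpp_def random_vec_def)

lemma sets_vec_nifpp [simp]: "sets V = sets (vec_rpm_space d P0)"
  unfolding vec_nifpp_eq by (rule sets_bind_measurable[OF vec_kernel_in_subprob]) simp

text \<open>The integral is unfolded along the mixture over \<open>M\<close>, the image map and
  Fubini. The value \<open>M = 0\<close> has mass zero under \<open>q\<close>; for all others
  \<open>random_vec M\<close> is measurable and the change of variables applies.\<close>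

lemma nn_integral_vec_nifpp:
  assumes g: "g \<in> borel_measurable (vec_rpm_space d P0)"
  shows "(\<integral>\<^sup>+p. g p \<partial>V)
    = (\<integral>\<^sup>+M. \<integral>\<^sup>+S. \<integral>\<^sup>+\<tau>. g (random_vec M (S, \<tau>)) \<partial>atom_space M \<partial>jump_space M \<partial>measure_pmf q)"
  unfolding vec_nifpp_eq nn_integral_bind[OF g vec_kernel_in_subprob]
proof (intro nn_integral_cong_AE AE_pmfI)
  fix M assume "M \<in> set_pmf q"
  then have "M \<noteq> 0" using no_zero by (metis set_pmf_iff)
  then have R: "random_vec M \<in> jump_space M \<Otimes>\<^sub>M atom_space M \<rightarrow>\<^sub>M vec_rpm_space d P0"
    by (intro measurable_random_vec) simp
  have "(\<integral>\<^sup>+p. g p \<partial>distr (jump_space M \<Otimes>\<^sub>M atom_space M) (vec_rpm_space d P0) (random_vec M))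
      = (\<integral>\<^sup>+z. g (random_vec M z) \<partial>(jump_space M \<Otimes>\<^sub>M atom_space M))"
    using g by (intro nn_integral_distr[OF R]) simp
  also have "\<dots> = (\<integral>\<^sup>+S. \<integral>\<^sup>+\<tau>. g (random_vec M (S, \<tau>)) \<partial>atom_space M \<partial>jump_space M)"
    by (rule sigma_finite_measure.nn_integral_fst[OF prob_space_imp_sigma_finite[OF prob_space_atom_space], symmetric]) (rule measurable_compose[OF R g])
  finally show "(\<integral>\<^sup>+p. g p \<partial>distr (jump_space M \<Otimes>\<^sub>M atom_space M) (vec_rpm_space d P0) (random_vec M)) = \<dots>" .
qed

lemma sample_law_eq: "sample_law V j l a b = V \<bind> sample_kernel j l a b"
  by (simp add: sample_law_def sample_kernel_def[abs_def])

lemma prob_space_vec_component: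
  assumes "p \<in> space (vec_rpm_space d P0)" "i \<in> {1..d}"
  shows "prob_space (p i)"
  using assms by (auto simp: vec_rpm_space_def space_PiM PiE_iff space_prob_algebra)

lemma measurable_vec_measure:
  assumes "i \<in> {1..d}" "A \<in> sets P0"
  shows "(\<lambda>p. measure (p i) A) \<in> borel_measurable (vec_rpm_space d P0)"
  unfolding vec_rpm_space_def
  by (rule measurable_compose[OF measurable_component_singleton[OF assms(1)]
      measurable_measure_prob_algebra[OF assms(2)]])

section \<open>Averages over the atoms for a fixed labelling\<close>

abbreviation rectangle :: "nat \<Rightarrow> nat \<Rightarrow> 'a set \<Rightarrow> 'a set \<Rightarrow> ((nat \<Rightarrow> 'a) \<times> (nat \<Rightarrow> 'a)) set" where
  "rectangle a b A B \<equiv> (\<Pi>\<^sub>E i\<in>{1..a}. A) \<times> (\<Pi>\<^sub>E i\<in>{1..b}. B)"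

lemma sets_rectangle:
  assumes "A \<in> sets P0" "B \<in> sets P0"
  shows "rectangle a b A B \<in> sets (sample_space a b)"
  using assms by (intro pair_measureI sets_PiM_I_finite) auto

text \<open>The constraints are grouped by atom: an atom used by the first sample must lie in
  \<open>A\<close>, by the second in \<open>B\<close>, by both in the intersection. Distinct indices
  carry independent atoms, so the probabilities multiply.\<close>

lemma nn_integral_atoms_rectangle:
  assumes A: "A \<in> sets P0" and B: "B \<in> sets P0"
    and L: "L \<in> {1..a} \<rightarrow> {1..M}" and L': "L' \<in> {1..b} \<rightarrow> {1..M}"
  shows "(\<integral>\<^sup>+\<tau>. indicator (rectangle a b A B) (\<lambda>i\<in>{1..a}. \<tau> (L i), \<lambda>i\<in>{1..b}. \<tau> (L' i)) \<partial>atom_space M)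
    = (\<Prod>m\<in>L ` {1..a} \<union> L' ` {1..b}. emeasure P0
        ((if m \<in> L ` {1..a} then A else space P0) \<inter> (if m \<in> L' ` {1..b} then B else space P0)))"
proof -
  let ?U = "L ` {1..a} \<union> L' ` {1..b}"
  \<comment> \<open>\<open>space P0\<close> stands for the absence of a constraint, so one
    expression covers atoms used by either sample or by both.\<close>
  let ?C = "\<lambda>m. (if m \<in> L ` {1..a} then A else space P0) \<inter> (if m \<in> L' ` {1..b} then B else space P0)"
  let ?E = "{\<tau> \<in> space (atom_space M). \<forall>m\<in>?U. \<tau> m \<in> ?C m}"
  have ball_split: "(\<forall>m\<in>S. t m \<in> A) \<and> (\<forall>m\<in>T. t m \<in> B)
      \<longleftrightarrow> (\<forall>m\<in>S \<union> T. t m \<in> (if m \<in> S then A else space P0) \<inter> (if m \<in> T then B else space P0))"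
    if "\<And>m. m \<in> S \<union> T \<Longrightarrow> t m \<in> space P0" for S T :: "nat set" and t
    using that by auto
  have U: "?U \<subseteq> {1..M}" "finite ?U" using L L' by auto
  have C: "?C m \<in> sets P0" for m using A B by auto
  have E: "?E \<in> sets (atom_space M)"
    using U C by (intro sets.sets_Collect_finite_All sets_Collect_single) auto
  have "(\<integral>\<^sup>+\<tau>. indicator (rectangle a b A B) (\<lambda>i\<in>{1..a}. \<tau> (L i), \<lambda>i\<in>{1..b}. \<tau> (L' i)) \<partial>atom_space M)
      = (\<integral>\<^sup>+\<tau>. indicator ?E \<tau> \<partial>atom_space M)"
  proof (rule nn_integral_cong)
    fix \<tau> assume \<tau>: "\<tau> \<in> space (atom_space M)"
    have sp: "\<tau> m \<in> space P0" if "m \<in> ?U" for m using \<tau> U that by (auto simp: space_PiM)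
    have "((\<lambda>i\<in>{1..a}. \<tau> (L i), \<lambda>i\<in>{1..b}. \<tau> (L' i)) \<in> rectangle a b A B)
        \<longleftrightarrow> (\<forall>m\<in>L ` {1..a}. \<tau> m \<in> A) \<and> (\<forall>m\<in>L' ` {1..b}. \<tau> m \<in> B)"
      by (auto simp: PiE_iff)
    also have "\<dots> \<longleftrightarrow> \<tau> \<in> ?E"
      using ball_split[of "L ` {1..a}" "L' ` {1..b}" \<tau>, OF sp] \<tau> by (simp only: mem_Collect_eq simp_thms)
    finally show "indicator (rectangle a b A B) (\<lambda>i\<in>{1..a}. \<tau> (L i), \<lambda>i\<in>{1..b}. \<tau> (L' i))
        = (indicator ?E \<tau> :: ennreal)"
      unfolding indicator_def by (simp only:)
  qed
  also have "\<dots> = emeasure (atom_space M) ?E" using E by (rule nn_integral_indicator)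
  also have "\<dots> = (\<Prod>m\<in>?U. emeasure P0 (?C m))"
    by (rule atoms.emeasure_PiM_Collect[OF U C])
  finally show ?thesis .
qed

lemma num_clusters_labels:
  assumes "inj_on \<tau> {1..M}" "L \<in> {1..a} \<rightarrow> {1..M}" "L' \<in> {1..b} \<rightarrow> {1..M}"
  shows "num_clusters a b (\<lambda>i\<in>{1..a}. \<tau> (L i), \<lambda>i\<in>{1..b}. \<tau> (L' i)) = card (L ` {1..a} \<union> L' ` {1..b})"
proof -
  have "num_clusters a b (\<lambda>i\<in>{1..a}. \<tau> (L i), \<lambda>i\<in>{1..b}. \<tau> (L' i)) = card (\<tau> ` (L ` {1..a} \<union> L' ` {1..b}))"
    by (simp add: num_clusters_def image_Un image_image)
  also have "\<dots> = card (L ` {1..a} \<union> L' ` {1..b})"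
    using assms by (intro card_image) (auto elim!: inj_on_subset)
  finally show ?thesis .
qed

text \<open>Diffuseness enters the identities here: almost surely \<open>\<tau>\<close> is injective
  on the indices, so observations coincide exactly when their labels do and the integrand is almost
  surely constant.\<close>

lemma nn_integral_atoms_num_clusters:
  assumes "L \<in> {1..a} \<rightarrow> {1..M}" "L' \<in> {1..b} \<rightarrow> {1..M}"
  shows "(\<integral>\<^sup>+\<tau>. g (num_clusters a b (\<lambda>i\<in>{1..a}. \<tau> (L i), \<lambda>i\<in>{1..b}. \<tau> (L' i))) \<partial>atom_space M)
    = g (card (L ` {1..a} \<union> L' ` {1..b}))"
proof -
  have "AE \<tau> in atom_space M. num_clusters a b (\<lambda>i\<in>{1..a}. \<tau> (L i), \<lambda>i\<in>{1..b}. \<tau> (L' i))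
      = card (L ` {1..a} \<union> L' ` {1..b})"
    using AE_atoms_distinct[OF finite_atLeastAtMost] by (rule eventually_mono) (rule num_clusters_labels[OF _ assms])
  then have "(\<integral>\<^sup>+\<tau>. g (num_clusters a b (\<lambda>i\<in>{1..a}. \<tau> (L i), \<lambda>i\<in>{1..b}. \<tau> (L' i))) \<partial>atom_space M)
      = (\<integral>\<^sup>+\<tau>. g (card (L ` {1..a} \<union> L' ` {1..b})) \<partial>atom_space M)"
    by (intro nn_integral_cong_AE) (elim eventually_mono, simp only:)
  then show ?thesis
    by (simp only: nn_integral_const prob_space.emeasure_space_1[OF prob_space_atom_space] mult_1_right)
qed

section \<open>Identities in the extended nonnegative reals\<close>

context
  fixes j l :: nat
  assumes j: "j \<in> {1..d}" and l: "l \<in> {1..d}"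
begin

lemma sample_kernel_subprob:
  "sample_kernel j l a b \<in> V \<rightarrow>\<^sub>M subprob_algebra (sample_space a b)"
  using measurable_prob_algebraD[OF measurable_sample_kernel[OF j l]]
  by (simp add: measurable_cong_sets[OF sets_vec_nifpp refl])

lemma nn_integral_sample_law:
  assumes "f \<in> borel_measurable (sample_space a b)"
  shows "(\<integral>\<^sup>+z. f z \<partial>sample_law V j l a b) = (\<integral>\<^sup>+p. \<integral>\<^sup>+z. f z \<partial>sample_kernel j l a b p \<partial>V)"
  unfolding sample_law_eq by (rule nn_integral_bind[OF assms sample_kernel_subprob])

text \<open>Given the jumps, a sample is \<open>\<tau>\<close> composed with random labels that are independent of \<open>\<tau>\<close>, so two
  statistics with the same \<open>\<tau>\<close>-average for each fixed labelling have the same mean.\<close>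

lemma nn_integral_sample_law_eqI:
  assumes f: "f \<in> borel_measurable (sample_space a b)" and g: "g \<in> borel_measurable (sample_space a b)"
    and eq: "\<And>M L L'. 1 \<le> M \<Longrightarrow> L \<in> {1..a} \<rightarrow> {1..M} \<Longrightarrow> L' \<in> {1..b} \<rightarrow> {1..M} \<Longrightarrow>
      (\<integral>\<^sup>+\<tau>. f (\<lambda>i\<in>{1..a}. \<tau> (L i), \<lambda>i\<in>{1..b}. \<tau> (L' i)) \<partial>atom_space M)
      = (\<integral>\<^sup>+\<tau>. g (\<lambda>i\<in>{1..a}. \<tau> (L i), \<lambda>i\<in>{1..b}. \<tau> (L' i)) \<partial>atom_space M)"
  shows "(\<integral>\<^sup>+z. f z \<partial>sample_law V j l a b) = (\<integral>\<^sup>+z. g z \<partial>sample_law V j l a b)"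
proof -
  have meas: "(\<lambda>p. \<integral>\<^sup>+z. h z \<partial>sample_kernel j l a b p) \<in> borel_measurable (vec_rpm_space d P0)"
    if "h \<in> borel_measurable (sample_space a b)" for h
    using measurable_compose[OF measurable_prob_algebraD[OF measurable_sample_kernel[OF j l]]
      nn_integral_measurable_subprob_algebra[OF that]] by simp
  show ?thesis
    unfolding nn_integral_sample_law[OF f] nn_integral_sample_law[OF g]
      nn_integral_vec_nifpp[OF meas[OF f]] nn_integral_vec_nifpp[OF meas[OF g]]
  proof (rule nn_integral_cong_AE, rule AE_pmfI, rule nn_integral_cong)
    fix M S assume "M \<in> set_pmf q" and S: "S \<in> space (jump_space M)"
    then have "M \<noteq> 0" using no_zero by (metis set_pmf_iff)
    then have M: "1 \<le> M" by simp
    show "(\<integral>\<^sup>+\<tau>. \<integral>\<^sup>+z. f z \<partial>sample_kernel j l a b (random_vec M (S, \<tau>)) \<partial>atom_space M)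
        = (\<integral>\<^sup>+\<tau>. \<integral>\<^sup>+z. g z \<partial>sample_kernel j l a b (random_vec M (S, \<tau>)) \<partial>atom_space M)"
      unfolding nn_integral_sample_kernel_mixture[OF M S j l f] nn_integral_sample_kernel_mixture[OF M S j l g]
      by (intro nn_integral_cong_AE AE_pmfI eq M Pi_I label_in_range[OF M S j] label_in_range[OF M S l])
  qed
qed

text \<open>Turns moments of the random measures into the probability of an event about the sample:
  given \<open>p\<close>, the observations are independent, so the rectangle has the product of the
  individual probabilities.\<close>

lemma nn_integral_sample_law_rectangle:
  assumes A: "A \<in> sets P0" and B: "B \<in> sets P0"
  shows "(\<integral>\<^sup>+z. indicator (rectangle a b A B) z \<partial>sample_law V j l a b)
    = (\<integral>\<^sup>+p. emeasure (p j) A ^ a * emeasure (p l) B ^ b \<partial>V)"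
proof -
  have "(\<integral>\<^sup>+z. indicator (rectangle a b A B) z \<partial>sample_kernel j l a b p)
      = emeasure (p j) A ^ a * emeasure (p l) B ^ b" if "p \<in> space V" for p
  proof -
    have p: "p \<in> space (vec_rpm_space d P0)"
      using that sets_eq_imp_space_eq[OF sets_vec_nifpp] by simp
    then have pj: "sets (p j) = sets P0" "prob_space (p j)" and pl: "sets (p l) = sets P0" "prob_space (p l)"
      using j l by (auto simp: vec_rpm_space_def space_PiM PiE_iff space_prob_algebra)
    interpret pj: prob_space "p j" by fact
    interpret pl: prob_space "p l" by fact
    interpret pj: product_prob_space "\<lambda>_. p j" "{1..a}" by unfold_locales
    interpret pl: product_prob_space "\<lambda>_. p l" "{1..b}" by unfold_locales
    have *: "(\<Pi>\<^sub>E i\<in>{1..a}. A) \<in> sets (\<Pi>\<^sub>M i\<in>{1..a}. p j)" "(\<Pi>\<^sub>E i\<in>{1..b}. B) \<in> sets (\<Pi>\<^sub>M i\<in>{1..b}. p l)"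
      using A B pj pl by (auto intro!: sets_PiM_I_finite)
    then have "rectangle a b A B \<in> sets (sample_kernel j l a b p)"
      unfolding sample_kernel_def by (rule pair_measureI)
    then have "(\<integral>\<^sup>+z. indicator (rectangle a b A B) z \<partial>sample_kernel j l a b p)
        = emeasure (sample_kernel j l a b p) (rectangle a b A B)"
      by (rule nn_integral_indicator)
    also have "\<dots> = emeasure (\<Pi>\<^sub>M i\<in>{1..a}. p j) (\<Pi>\<^sub>E i\<in>{1..a}. A) * emeasure (\<Pi>\<^sub>M i\<in>{1..b}. p l) (\<Pi>\<^sub>E i\<in>{1..b}. B)"
      unfolding sample_kernel_def by (rule pl.P.emeasure_pair_measure_Times[OF *])
    also have "\<dots> = emeasure (p j) A ^ a * emeasure (p l) B ^ b"
      using A B pj pl by (simp add: pj.emeasure_PiM pl.emeasure_PiM)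
    finally show ?thesis .
  qed
  then show ?thesis
    using sets_rectangle[OF A B] by (subst nn_integral_sample_law) (auto intro!: nn_integral_cong)
qed

text \<open>With both sets equal to \<open>A\<close>, every atom in use is constrained to
  \<open>A\<close>, whichever sample uses it. For a fixed labelling the probability is thus a power
  of \<open>emeasure P0 A\<close>, with the number of distinct labels as exponent.\<close>

lemma nn_moment_identity:
  assumes A: "A \<in> sets P0"
  shows "(\<integral>\<^sup>+p. emeasure (p j) A ^ a * emeasure (p l) A ^ b \<partial>V)
    = (\<integral>\<^sup>+z. emeasure P0 A ^ num_clusters a b z \<partial>sample_law V j l a b)"
  unfolding nn_integral_sample_law_rectangle[OF A A, symmetric]
proof (rule nn_integral_sample_law_eqI)
  fix M :: nat and L L' assume L: "L \<in> {1..a} \<rightarrow> {1..M}" and L': "L' \<in> {1..b} \<rightarrow> {1..M}"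
  have "(\<Prod>m\<in>L ` {1..a} \<union> L' ` {1..b}. emeasure P0
        ((if m \<in> L ` {1..a} then A else space P0) \<inter> (if m \<in> L' ` {1..b} then A else space P0)))
      = (\<Prod>m\<in>L ` {1..a} \<union> L' ` {1..b}. emeasure P0 A)"
    using sets.sets_into_space[OF A]
    by (intro prod.cong refl arg_cong[where f="emeasure P0"]) (simp only: Un_iff split: if_splits, blast)
  then show "(\<integral>\<^sup>+\<tau>. indicator (rectangle a b A A) (\<lambda>i\<in>{1..a}. \<tau> (L i), \<lambda>i\<in>{1..b}. \<tau> (L' i)) \<partial>atom_space M)
      = (\<integral>\<^sup>+\<tau>. emeasure P0 A ^ num_clusters a b (\<lambda>i\<in>{1..a}. \<tau> (L i), \<lambda>i\<in>{1..b}. \<tau> (L' i)) \<partial>atom_space M)"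
    unfolding nn_integral_atoms_rectangle[OF A A L L'] nn_integral_atoms_num_clusters[OF L L', where g="\<lambda>k. emeasure P0 A ^ k"]
    by simp
qed (use sets_rectangle[OF A A] in measurable)

text \<open>With one observation in each sample, equal labels put a single atom in
  \<open>A \<inter> B\<close>, while different labels put independent atoms in \<open>A\<close> and
  \<open>B\<close>. The first case is almost surely that of a single cluster.\<close>

lemma nn_covariance_identity:
  assumes A: "A \<in> sets P0" and B: "B \<in> sets P0"
  shows "(\<integral>\<^sup>+p. emeasure (p j) A * emeasure (p l) B \<partial>V)
    = (\<integral>\<^sup>+z. (if num_clusters 1 1 z = 1 then emeasure P0 (A \<inter> B) else emeasure P0 A * emeasure P0 B)
        \<partial>sample_law V j l 1 1)"
  using nn_integral_sample_law_rectangle[OF A B, of 1 1, symmetric]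
  unfolding power_one_right
proof (rule trans, intro nn_integral_sample_law_eqI)
  fix M L L' assume L: "L \<in> {1..1 :: nat} \<rightarrow> {1..M :: nat}" and L': "L' \<in> {1..1 :: nat} \<rightarrow> {1..M}"
  have im: "L ` {1..1} = {L 1}" "L' ` {1..1} = {L' 1}" by auto
  have AB: "A \<inter> space P0 = A" "space P0 \<inter> B = B"
    using sets.sets_into_space[OF A] sets.sets_into_space[OF B] by auto
  show "(\<integral>\<^sup>+\<tau>. indicator (rectangle 1 1 A B) (\<lambda>i\<in>{1..1}. \<tau> (L i), \<lambda>i\<in>{1..1}. \<tau> (L' i)) \<partial>atom_space M)
      = (\<integral>\<^sup>+\<tau>. (if num_clusters 1 1 (\<lambda>i\<in>{1..1}. \<tau> (L i), \<lambda>i\<in>{1..1}. \<tau> (L' i)) = 1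
          then emeasure P0 (A \<inter> B) else emeasure P0 A * emeasure P0 B) \<partial>atom_space M)"
    unfolding nn_integral_atoms_rectangle[OF A B L L'] im
      nn_integral_atoms_num_clusters[OF L L', where g="\<lambda>k. if k = 1 then emeasure P0 (A \<inter> B) else emeasure P0 A * emeasure P0 B"]
    by (cases "L 1 = L' 1") (simp_all add: AB mult.commute)
qed (use sets_rectangle[OF A B] in measurable)

section \<open>Passage to real-valued expectations\<close>

text \<open>The assumption is discharged in the theorem, where \<open>V\<close> is the law of a
  random vector on a probability space.\<close>

context
  assumes V: "prob_space V"
begin

lemma
  shows prob_space_sample_law: "prob_space (sample_law V j l a b)"
    and sets_sample_law: "sets (sample_law V j l a b) = sets (sample_space a b)"
proof -
  have *: "V \<in> space (prob_algebra (vec_rpm_space d P0))"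
    using V by (simp add: space_prob_algebra)
  show "prob_space (sample_law V j l a b)" "sets (sample_law V j l a b) = sets (sample_space a b)"
    unfolding sample_law_eq using prob_space_bind'[OF * measurable_sample_kernel[OF j l]]
      sets_bind'[OF * measurable_sample_kernel[OF j l]] by auto
qed

lemma measurable_num_clusters_sample_law [measurable]:
  "num_clusters a b \<in> sample_law V j l a b \<rightarrow>\<^sub>M count_space UNIV"
  using measurable_num_clusters by (simp add: measurable_cong_sets[OF sets_sample_law refl])

text \<open>Both integrands are nonnegative and measurable, so their Bochner integrals are
  determined by the nonnegative integrals that \<open>eq\<close> identifies. Components of
  \<open>p\<close> have finite mass, which lets \<open>ennreal\<close> pass through powers and
  products.\<close>

lemma integral_vec_eq_integral_sample_law:
  assumes A: "A \<in> sets P0" and B: "B \<in> sets P0" and g: "\<And>k. 0 \<le> g k"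
    and eq: "(\<integral>\<^sup>+p. emeasure (p j) A ^ a * emeasure (p l) B ^ b \<partial>V)
      = (\<integral>\<^sup>+z. ennreal (g (num_clusters a b z)) \<partial>sample_law V j l a b)"
  shows "(\<integral>p. measure (p j) A ^ a * measure (p l) B ^ b \<partial>V)
    = (\<integral>z. g (num_clusters a b z) \<partial>sample_law V j l a b)"
proof -
  have "(\<integral>\<^sup>+p. ennreal (measure (p j) A ^ a * measure (p l) B ^ b) \<partial>V)
      = (\<integral>\<^sup>+p. emeasure (p j) A ^ a * emeasure (p l) B ^ b \<partial>V)"
  proof (rule nn_integral_cong)
    fix p assume "p \<in> space V"
    then have p: "p \<in> space (vec_rpm_space d P0)"
      using sets_eq_imp_space_eq[OF sets_vec_nifpp] by simp
    interpret pj: prob_space "p j" by (rule prob_space_vec_component[OF p j])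
    interpret pl: prob_space "p l" by (rule prob_space_vec_component[OF p l])
    show "ennreal (measure (p j) A ^ a * measure (p l) B ^ b) = emeasure (p j) A ^ a * emeasure (p l) B ^ b"
      by (simp add: pj.emeasure_eq_measure pl.emeasure_eq_measure ennreal_power ennreal_mult)
  qed
  moreover have "(\<lambda>p. measure (p j) A ^ a * measure (p l) B ^ b) \<in> borel_measurable V"
    unfolding measurable_cong_sets[OF sets_vec_nifpp refl]
    using measurable_vec_measure[OF j A] measurable_vec_measure[OF l B] by measurable
  moreover have "(\<lambda>z. g (num_clusters a b z)) \<in> borel_measurable (sample_law V j l a b)"
    by measurable
  ultimately show ?thesis
    using g by (simp add: integral_eq_nn_integral eq)
qed

lemma moment_identity:
  assumes A: "A \<in> sets P0"
  shows "(\<integral>p. measure (p j) A ^ a * measure (p l) A ^ b \<partial>V)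
    = (\<integral>z. prob A ^ num_clusters a b z \<partial>sample_law V j l a b)"
  using nn_moment_identity[OF A, of a b]
  by (intro integral_vec_eq_integral_sample_law A)
    (simp_all add: emeasure_eq_measure ennreal_power)

lemma covariance_identity:
  assumes A: "A \<in> sets P0" and B: "B \<in> sets P0"
  shows "(\<integral>p. measure (p j) A * measure (p l) B \<partial>V) - prob A * prob B
    = \<P>(z in sample_law V j l 1 1. num_clusters 1 1 z = 1) * (prob (A \<inter> B) - prob A * prob B)"
proof -
  let ?S = "sample_law V j l 1 1" and ?g = "\<lambda>k :: nat. if k = 1 then prob (A \<inter> B) else prob A * prob B"
  interpret S: prob_space ?S by (rule prob_space_sample_law)
  let ?E = "{z \<in> space ?S. num_clusters 1 1 z = 1}"
  have E: "?E \<in> S.events" by measurable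
  have "(\<integral>\<^sup>+p. emeasure (p j) A ^ 1 * emeasure (p l) B ^ 1 \<partial>V) = (\<integral>\<^sup>+z. ennreal (?g (num_clusters 1 1 z)) \<partial>?S)"
    using nn_covariance_identity[OF A B] unfolding power_one_right
    by (simp add: emeasure_eq_measure ennreal_mult if_distrib[of ennreal] cong: if_cong)
  then have "(\<integral>p. measure (p j) A ^ 1 * measure (p l) B ^ 1 \<partial>V) = (\<integral>z. ?g (num_clusters 1 1 z) \<partial>?S)"
    by (intro integral_vec_eq_integral_sample_law A B) simp_all
  \<comment> \<open>The two-valued integrand is split into its value off the single-cluster event
    plus the increment on that event. The increment may be negative, hence the passage to real
    integrals beforehand.\<close>
  also have "\<dots> = (\<integral>z. prob A * prob B + indicator ?E z * (prob (A \<inter> B) - prob A * prob B) \<partial>?S)"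
    by (rule Bochner_Integration.integral_cong) (simp_all add: indicator_def)
  also have "\<dots> = prob A * prob B + S.prob ?E * (prob (A \<inter> B) - prob A * prob B)"
    by (rule S.expectation_const_plus_indicator[OF E])
  finally show ?thesis by simp
qed

text \<open>The number of clusters takes values in \<open>{1..a + b}\<close>, so the power
  decomposes over its level sets and the sum is integrated term by term.\<close>

lemma integral_num_clusters:
  fixes x :: real
  assumes a: "1 \<le> a"
  shows "(\<integral>z. x ^ num_clusters a b z \<partial>sample_law V j l a b)
    = (\<Sum>k=1..a + b. x ^ k * \<P>(z in sample_law V j l a b. num_clusters a b z = k))"
proof -
  let ?S = "sample_law V j l a b"
  interpret S: prob_space ?S by (rule prob_space_sample_law)
  let ?E = "\<lambda>k. {z \<in> space ?S. num_clusters a b z = k}"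
  have E: "?E k \<in> S.events" for k by measurable
  have bounds: "num_clusters a b z \<in> {1..a + b}" for z :: "(nat \<Rightarrow> 'a) \<times> (nat \<Rightarrow> 'a)"
  proof -
    have "card (fst z ` {1..a} \<union> snd z ` {1..b}) \<le> card (fst z ` {1..a}) + card (snd z ` {1..b})"
      by (rule card_Un_le)
    also have "\<dots> \<le> a + b"
      using card_image_le[of "{1..a}" "fst z"] card_image_le[of "{1..b}" "snd z"] by simp
    finally have "card (fst z ` {1..a} \<union> snd z ` {1..b}) \<le> a + b" .
    \<comment> \<open>The lower end of the sum is 1 because the first sample is nonempty, by
      \<open>1 \<le> a\<close>.\<close>
    moreover have "1 \<le> card (fst z ` {1..a} \<union> snd z ` {1..b})"
      using a by (simp add: Suc_le_eq card_gt_0_iff)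
    ultimately show ?thesis by (simp only: num_clusters_def split_beta atLeastAtMost_iff simp_thms)
  qed
  have "(\<integral>z. x ^ num_clusters a b z \<partial>?S) = (\<integral>z. (\<Sum>k=1..a + b. x ^ k * indicator (?E k) z) \<partial>?S)"
  proof (rule Bochner_Integration.integral_cong[OF refl])
    fix z assume z: "z \<in> space ?S"
    have "(\<Sum>k=1..a + b. x ^ k * indicator (?E k) z) = (\<Sum>k=1..a + b. if num_clusters a b z = k then x ^ k else 0)"
      using z by (intro sum.cong) (auto simp: indicator_def)
    then show "x ^ num_clusters a b z = (\<Sum>k=1..a + b. x ^ k * indicator (?E k) z)"
      using bounds[of z] by simp
  qed
  also have "\<dots> = (\<Sum>k=1..a + b. x ^ k * S.prob (?E k))"
    using E by (subst Bochner_Integration.integral_sum) (simp_all add: S.emeasure_eq_measure)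
  finally show ?thesis .
qed

end

end

end

section \<open>Transfer to a random vector with the prescribed law\<close>

theorem theorem2:
  fixes d :: nat and \<Theta> :: "(real ^ 's) set" and P0 :: "(real ^ 's) measure"
    and q :: "nat pmf" and h :: "real \<Rightarrow> real \<Rightarrow> real" and \<gamma> :: "nat \<Rightarrow> real"
    and H :: "nat \<Rightarrow> real measure" and V :: "(nat \<Rightarrow> (real ^ 's) measure) measure"
    and \<Omega> :: "'w measure" and P :: "nat \<Rightarrow> 'w \<Rightarrow> (real ^ 's) measure"
  assumes "d \<ge> 1"
    and "\<Theta> \<in> sets borel"
    and "prob_space P0" and "sets P0 = sets (restrict_space borel \<Theta>)"
    and "\<forall>x\<in>\<Theta>. measure P0 {x} = 0"
    and "pmf q 0 = 0"
    and "param_density_family h"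
    and "\<forall>j\<in>{1..d}. \<gamma> j > 0"
    and "H = (\<lambda>j. jump_law h (\<gamma> j))"
    and "V = vec_nifpp d q H P0"
    and "prob_space \<Omega>"
    and "(\<lambda>\<omega>. \<lambda>j\<in>{1..d}. P j \<omega>) \<in> \<Omega> \<rightarrow>\<^sub>M vec_rpm_space d P0"
    and "distr \<Omega> (vec_rpm_space d P0) (\<lambda>\<omega>. \<lambda>j\<in>{1..d}. P j \<omega>) = V"
  shows "(\<forall>A\<in>sets P0. \<forall>j\<in>{1..d}. (\<integral>\<omega>. measure (P j \<omega>) A \<partial>\<Omega>) = measure P0 A)
    \<and> (\<forall>A\<in>sets P0. \<forall>B\<in>sets P0. \<forall>j\<in>{1..d}. \<forall>l\<in>{1..d}.
        (\<integral>\<omega>. measure (P j \<omega>) A * measure (P l \<omega>) B \<partial>\<Omega>) - measure P0 A * measure P0 B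
          = \<P>(z in sample_law V j l 1 1. num_clusters 1 1 z = 1)
            * (measure P0 (A \<inter> B) - measure P0 A * measure P0 B))
    \<and> (\<forall>A\<in>sets P0. \<forall>j\<in>{1..d}. \<forall>l\<in>{1..d}. \<forall>nj\<ge>1. \<forall>nl\<ge>1.
        (\<integral>\<omega>. measure (P j \<omega>) A ^ nj * measure (P l \<omega>) A ^ nl \<partial>\<Omega>)
          = (\<integral>z. measure P0 A ^ num_clusters nj nl z \<partial>sample_law V j l nj nl)
      \<and> (\<integral>z. measure P0 A ^ num_clusters nj nl z \<partial>sample_law V j l nj nl)
          = (\<Sum>k=1..nj + nl. measure P0 A ^ k *
              \<P>(z in sample_law V j l nj nl. num_clusters nj nl z = k)))"
proof -
  interpret P0: prob_space P0 by fact
  have sp: "space P0 = \<Theta>"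
    using sets_eq_imp_space_eq[OF assms(4)] by (simp add: space_restrict_space)
  interpret N: nifpp P0 d q H
  proof (intro nifpp.intro diffuse_prob_space.intro diffuse_prob_space_axioms.intro nifpp_axioms.intro)
    show "prob_space P0" by fact
    show "(\<lambda>x. x) \<in> borel_measurable P0"
      unfolding measurable_cong_sets[OF assms(4) refl] by (intro measurable_restrict_space1) simp
    show "emeasure P0 {x} = 0" if "x \<in> space P0" for x
      using that assms(5) by (simp add: P0.emeasure_eq_measure sp)
    show "prob_space (H j)" if "j \<in> {1..d}" for j
      using that assms(7-9) by (simp add: param_density_family_def)
    show "sets (H j) = sets (restrict_space borel {0<..})" for j
      by (simp add: assms(9) jump_law_def sets_restrict_space)
    show "pmf q 0 = 0" by fact
  qed
  let ?V = "vec_nifpp d q H P0" and ?R = "\<lambda>\<omega>. \<lambda>j\<in>{1..d}. P j \<omega>"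
  have distr: "distr \<Omega> (vec_rpm_space d P0) ?R = ?V"
    using assms(13) unfolding assms(10) .
  \<comment> \<open>The total mass one is inherited from \<open>\<Omega>\<close>, through the
    identification of \<open>?V\<close> with an image law.\<close>
  have V: "prob_space ?V"
    using prob_space.prob_space_distr[OF assms(11,12)] unfolding distr .
  \<comment> \<open>Change of variables from \<open>\<Omega>\<close> to the law of the vector; the
    restriction to \<open>{1..d}\<close> is harmless for indices in that range.\<close>
  have transfer: "(\<integral>\<omega>. measure (P j \<omega>) A ^ a * measure (P l \<omega>) B ^ b \<partial>\<Omega>)
      = (\<integral>p. measure (p j) A ^ a * measure (p l) B ^ b \<partial>?V)"
    if "j \<in> {1..d}" "l \<in> {1..d}" "A \<in> sets P0" "B \<in> sets P0" for j l A B a b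
  proof -
    have "(\<lambda>p. measure (p j) A ^ a * measure (p l) B ^ b) \<in> borel_measurable (vec_rpm_space d P0)"
      using N.measurable_vec_measure[OF that(1,3)] N.measurable_vec_measure[OF that(2,4)] by measurable
    from integral_distr[OF assms(12) this] show ?thesis
      unfolding distr using that by simp
  qed
  have covariance: "(\<integral>\<omega>. measure (P j \<omega>) A * measure (P l \<omega>) B \<partial>\<Omega>) - measure P0 A * measure P0 B
      = \<P>(z in sample_law ?V j l 1 1. num_clusters 1 1 z = 1)
        * (measure P0 (A \<inter> B) - measure P0 A * measure P0 B)"
    if "j \<in> {1..d}" "l \<in> {1..d}" "A \<in> sets P0" "B \<in> sets P0" for j l A B
    using transfer[OF that, of 1 1] N.covariance_identity[OF that(1,2) V that(3,4)]
    by (simp only: power_one_right)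
  \<comment> \<open>Taking \<open>l = j\<close> and \<open>B = space P0\<close> in the covariance
    formula makes its right-hand side vanish, since \<open>A \<inter> B = A\<close> and
    \<open>B\<close> has mass one under \<open>P0\<close>.\<close>
  have mean: "(\<integral>\<omega>. measure (P j \<omega>) A \<partial>\<Omega>) = measure P0 A" if "j \<in> {1..d}" "A \<in> sets P0" for j A
  proof -
    have "(\<integral>\<omega>. measure (P j \<omega>) A * measure (P j \<omega>) (space P0) \<partial>\<Omega>) = measure P0 A"
      using covariance[OF that(1,1,2) sets.top] sets.sets_into_space[OF that(2)]
      by (simp add: P0.prob_space Int_absorb2)
    \<comment> \<open>The vector takes values in a product of spaces of probability measures, so the
      second factor is one at every sample point.\<close>
    moreover have "measure (P j \<omega>) (space P0) = 1" if "\<omega> \<in> space \<Omega>" for \<omega>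
    proof -
      have "P j \<omega> \<in> space (prob_algebra P0)"
        using measurable_space[OF assms(12) that] \<open>j \<in> {1..d}\<close>
        by (auto simp: vec_rpm_space_def space_PiM PiE_iff)
      then have "sets (P j \<omega>) = sets P0" "prob_space (P j \<omega>)"
        by (auto simp: space_prob_algebra)
      then show ?thesis by (metis prob_space.prob_space sets_eq_imp_space_eq)
    qed
    ultimately show ?thesis by (simp cong: Bochner_Integration.integral_cong)
  qed
  show ?thesis
    unfolding assms(10)
    by (intro conjI ballI allI impI mean covariance)
      (simp_all only: transfer N.moment_identity[OF _ _ V] N.integral_num_clusters[OF _ _ V])
qed

end
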